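(* Let $A=A^\top\in\mathbb{R}^{n\times n}$ be the adjacency matrix of an undirected, possibly weighted graph on $n$ vertices (nonnegative weights, not assumed connected), with nonsingular diagonal degree matrix $D$. Let $0<\alpha<1$, $L=I-\alpha D^{-1}A$, and let $w\in\mathbb{R}^n$ be a nonnegative vector. Let $z$ be the PageRank vector, i.e. the solution of $L^\top z=(1-\alpha)w$. Then $D^{-1}z$ is a discrete potential with empty boundary (hitting-set) and cost vector $c=(1-\alpha)D^{-1}w$; that is, $\phi=D^{-1}z$ is a nonnegative vector satisfying $L\phi=c$.
   Context: $D$ is the diagonal matrix whose $i$th diagonal entry is the $i$th row sum of $A$; it is assumed nonsingular (isolated vertices carry a self-loop), so all degrees are positive and $D^{-1}A$ is row-stochastic. For a disjoint partition $\Omega\cup\partial\Omega$ of the vertices, a discrete potential with nonnegative cost vector $c$ and boundary condition $f$ is a nonnegative vector $\phi$ solving $\Pi^\top L\Pi\,\phi=c$ on $\Omega$ and $\phi=f$ on $\partial\Omega$, where the columns of $\Pi$ are the columns of the $n\times n$ identity matrix associated with the vertices in $\Omega$. When $\partial\Omega=\emptyset$ one has $\Pi=I$ and the equations reduce to $L\phi=c$. *)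

theory Defs
  imports "HOL-Analysis.Analysis"
begin

definition adjacency_matrix :: "real^'n^'n \<Rightarrow> bool" where
  "adjacency_matrix A \<longleftrightarrow> transpose A = A \<and> (\<forall>i j. 0 \<le> A $ i $ j)"

definition degree_matrix :: "real^'n^'n \<Rightarrow> real^'n^'n" where
  "degree_matrix A = (\<chi> i j. if i = j then (\<Sum>k\<in>UNIV. A $ i $ k) else 0)"

definition pagerank_matrix :: "real \<Rightarrow> real^'n^'n \<Rightarrow> real^'n^'n" where
  "pagerank_matrix \<alpha> A = mat 1 - \<alpha> *\<^sub>R (matrix_inv (degree_matrix A) ** A)"

text \<open>The matrix \<open>\<Pi>\<close> is usually written with one column per vertex of \<open>\<Omega>\<close>. Here it
  is padded to a square matrix by zero columns for the vertices outside \<open>\<Omega>\<close>, so that it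
  acts on vectors indexed by all vertices. On \<open>\<Omega>\<close> the two versions of \<open>\<Pi>\<^sup>T L \<Pi> \<phi>\<close> agree,
  see \<open>selection_matrix_compression\<close>.\<close>

definition selection_matrix :: "'n::finite set \<Rightarrow> real^'n^'n" where
  "selection_matrix \<Omega> = (\<chi> i j. if j \<in> \<Omega> then (mat 1 :: real^'n^'n) $ i $ j else 0)"

text \<open>The vectors \<open>c\<close> and \<open>f\<close> are indexed by all vertices, but the equations only involve
  the entries of \<open>c\<close> on \<open>\<Omega>\<close> and those of \<open>f\<close> on the boundary \<open>B\<close>.\<close>

definition discrete_potential ::
    "real^'n^'n \<Rightarrow> 'n::finite set \<Rightarrow> 'n set \<Rightarrow> real^'n \<Rightarrow> real^'n \<Rightarrow> real^'n \<Rightarrow> bool" where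
  "discrete_potential L \<Omega> B c f \<phi> \<longleftrightarrow>
     \<Omega> \<inter> B = {} \<and> \<Omega> \<union> B = UNIV \<and> (\<forall>i\<in>\<Omega>. 0 \<le> c $ i) \<and> 0 \<le> \<phi> \<and>
     (\<forall>i\<in>\<Omega>. ((transpose (selection_matrix \<Omega>) ** L ** selection_matrix \<Omega>) *v \<phi>) $ i = c $ i) \<and>
     (\<forall>i\<in>B. \<phi> $ i = f $ i)"

lemma selection_matrix_UNIV: "selection_matrix UNIV = mat 1"
  by (simp add: selection_matrix_def vec_eq_iff)

lemma selection_matrix_compression:
  fixes L :: "real^'n^'n"
  assumes "i \<in> \<Omega>"
  shows "((transpose (selection_matrix \<Omega>) ** L ** selection_matrix \<Omega>) *v \<phi>) $ i
    = (\<Sum>j\<in>\<Omega>. L $ i $ j * \<phi> $ j)"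
proof -
  have "selection_matrix \<Omega> $ k $ j * \<phi> $ j = (if j = k then (if k \<in> \<Omega> then \<phi> $ k else 0) else 0)"
    for k j by (simp add: selection_matrix_def mat_def)
  then have v: "selection_matrix \<Omega> *v \<phi> = (\<chi> j. if j \<in> \<Omega> then \<phi> $ j else 0)"
    by (simp add: vec_eq_iff matrix_vector_mult_def)
  have "transpose (selection_matrix \<Omega>) $ i $ j * u $ j = (if j = i then u $ i else 0)"
    for u :: "real^'n" and j using assms by (simp add: selection_matrix_def transpose_def mat_def)
  then have t: "(transpose (selection_matrix \<Omega>) *v u) $ i = u $ i" for u :: "real^'n"
    by (simp add: matrix_vector_mult_def)
  have "((transpose (selection_matrix \<Omega>) ** L ** selection_matrix \<Omega>) *v \<phi>) $ i
      = (L *v (selection_matrix \<Omega> *v \<phi>)) $ i"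
    by (simp only: matrix_vector_mul_assoc[symmetric] t)
  also have "\<dots> = (\<Sum>j\<in>UNIV. if j \<in> \<Omega> then L $ i $ j * \<phi> $ j else 0)"
    unfolding v by (auto simp: matrix_vector_mult_def intro!: sum.cong)
  also have "\<dots> = (\<Sum>j\<in>\<Omega>. L $ i $ j * \<phi> $ j)"
    by (simp add: sum.If_cases)
  finally show ?thesis .
qed

end

theory Submission
  imports Defs
begin

text \<open>Since \<open>A\<close> and \<open>D\<close> are symmetric, \<open>L D\<inverse> = D\<inverse> L\<^sup>T\<close>, so \<open>D\<inverse>\<close> carries the PageRank
  equation to \<open>L \<phi> = c\<close>. As \<open>D\<inverse> A\<close> averages, at a vertex where \<open>\<phi>\<close> is minimal one has
  \<open>(L \<phi>)\<^sub>i \<le> (1 - \<alpha>) \<phi>\<^sub>i\<close>, and therefore \<open>c \<ge> 0\<close> forces \<open>\<phi> \<ge> 0\<close>.\<close>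

text \<open>With d the row sums, entry (i, j) of
  \<open>degree_matrix A ** matrix_inv (degree_matrix A) = mat 1\<close> says that d_i times the
  entry of the inverse is 1 or 0. The case i = j excludes d_i = 0; dividing by d_i then gives every
  entry of the inverse.\<close>

lemma invertible_degree_matrix:
  fixes A :: "real^'n^'n"
  assumes "invertible (degree_matrix A)"
  shows degree_nonzero: "(\<Sum>k\<in>UNIV. A $ i $ k) \<noteq> 0"
    and matrix_inv_degree_matrix: "matrix_inv (degree_matrix A) =
      (\<chi> i j. if i = j then 1 / (\<Sum>k\<in>UNIV. A $ i $ k) else 0)"
proof -
  have row: "(\<Sum>k\<in>UNIV. A $ i $ k) * matrix_inv (degree_matrix A) $ i $ j = (if i = j then 1 else 0)"
    for i j
  proof -
    \<comment> \<open>\<open>matrix_inv\<close> is a choice of a two-sided inverse; invertibility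
      ensures that the chosen matrix is one.\<close>
    have "(degree_matrix A ** matrix_inv (degree_matrix A)) $ i $ j = (mat 1 :: real^'n^'n) $ i $ j"
      using someI_ex[OF assms[unfolded invertible_def]] by (simp add: matrix_inv_def)
    then show ?thesis
      by (simp add: matrix_matrix_mult_def degree_matrix_def mat_def if_distrib[of "\<lambda>u. u * _"] cong: if_cong)
  qed
  show nz: "(\<Sum>k\<in>UNIV. A $ i $ k) \<noteq> 0" for i
    using row[of i i] by auto
  have "matrix_inv (degree_matrix A) $ i $ j = (if i = j then 1 / (\<Sum>k\<in>UNIV. A $ i $ k) else 0)"
    for i j
    using row[of i j] nz[of i] by (auto simp: field_simps split: if_splits)
  then show "matrix_inv (degree_matrix A) =
      (\<chi> i j. if i = j then 1 / (\<Sum>k\<in>UNIV. A $ i $ k) else 0)"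
    by (simp add: vec_eq_iff)
qed

lemma degree_positive:
  assumes "adjacency_matrix A" "invertible (degree_matrix A)"
  shows "0 < (\<Sum>k\<in>UNIV. A $ i $ k)"
proof -
  have "0 \<le> (\<Sum>k\<in>UNIV. A $ i $ k)"
    using assms(1) by (simp add: adjacency_matrix_def sum_nonneg)
  with degree_nonzero[OF assms(2), of i] show ?thesis by linarith
qed

lemma matrix_inv_degree_matrix_mult_nth:
  fixes A :: "real^'n^'n"
  assumes "invertible (degree_matrix A)"
  shows "(matrix_inv (degree_matrix A) *v x) $ i = x $ i / (\<Sum>k\<in>UNIV. A $ i $ k)"
  by (simp add: matrix_inv_degree_matrix[OF assms] matrix_vector_mult_def if_distrib[of "\<lambda>u. u * _"] cong: if_cong)

lemma transpose_matrix_inv_degree_matrix: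
  assumes "invertible (degree_matrix A)"
  shows "transpose (matrix_inv (degree_matrix A)) = matrix_inv (degree_matrix A)"
  by (auto simp: matrix_inv_degree_matrix[OF assms] transpose_def vec_eq_iff)

lemma pagerank_matrix_mult:
  "pagerank_matrix \<alpha> A *v x = x - \<alpha> *\<^sub>R (matrix_inv (degree_matrix A) *v (A *v x))"
  by (simp add: pagerank_matrix_def matrix_vector_mult_diff_rdistrib
      scaleR_matrix_vector_assoc[symmetric] matrix_vector_mul_assoc)

text \<open>Transposition reverses the product of the symmetric factors
  \<open>matrix_inv (degree_matrix A)\<close> and \<open>A\<close>.\<close>

lemma transpose_pagerank_matrix_mult:
  assumes "adjacency_matrix A" "invertible (degree_matrix A)"
  shows "transpose (pagerank_matrix \<alpha> A) *v x = x - \<alpha> *\<^sub>R (A *v (matrix_inv (degree_matrix A) *v x))"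
proof -
  have "transpose (pagerank_matrix \<alpha> A)
      = transpose (mat 1) - \<alpha> *\<^sub>R transpose (matrix_inv (degree_matrix A) ** A)"
    by (simp add: pagerank_matrix_def vec_eq_iff transpose_def)
  also have "\<dots> = mat 1 - \<alpha> *\<^sub>R (A ** matrix_inv (degree_matrix A))"
    using assms
    by (simp add: matrix_transpose_mul adjacency_matrix_def transpose_matrix_inv_degree_matrix)
  finally show ?thesis
    by (simp add: matrix_vector_mult_diff_rdistrib
        scaleR_matrix_vector_assoc[symmetric] matrix_vector_mul_assoc)
qed

text \<open>Writing D for the degree matrix, both sides expand to D^-1 x - \<alpha> D^-1 A D^-1
  x.\<close>

lemma pagerank_matrix_mult_matrix_inv_degree_matrix:
  assumes "adjacency_matrix A" "invertible (degree_matrix A)"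
  shows "pagerank_matrix \<alpha> A *v (matrix_inv (degree_matrix A) *v x)
    = matrix_inv (degree_matrix A) *v (transpose (pagerank_matrix \<alpha> A) *v x)"
  by (simp add: pagerank_matrix_mult transpose_pagerank_matrix_mult[OF assms]
      matrix_vector_mult_diff_distrib matrix_vector_mult_scaleR del: transpose_matrix_vector)

text \<open>This takes the place of a Neumann series argument for the nonnegativity of the inverse
  of L.\<close>

lemma pagerank_matrix_minimum_principle:
  fixes A :: "real^'n^'n"
  assumes A: "adjacency_matrix A" and D: "invertible (degree_matrix A)"
    and \<alpha>: "0 \<le> \<alpha>" "\<alpha> < 1"
    and L: "0 \<le> pagerank_matrix \<alpha> A *v x"
  shows "0 \<le> x"
proof -
  obtain i where i: "x $ i \<le> x $ j" for j
    using ex_is_arg_min_if_finite[of UNIV "\<lambda>j. x $ j"] by (auto simp: is_arg_min_linorder)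
  \<comment> \<open>The weights in row i are nonnegative, so replacing each \<open>x $ j\<close> by
    the minimum \<open>x $ i\<close> can only lower the sum.\<close>
  have "(\<Sum>j\<in>UNIV. A $ i $ j) * x $ i \<le> (A *v x) $ i"
    using A i by (simp add: adjacency_matrix_def matrix_vector_mult_def sum_distrib_right
        sum_mono mult_left_mono)
  then have "x $ i \<le> (A *v x) $ i / (\<Sum>j\<in>UNIV. A $ i $ j)"
    using degree_positive[OF A D, of i] by (simp add: field_simps)
  then have "\<alpha> * x $ i \<le> \<alpha> * ((A *v x) $ i / (\<Sum>j\<in>UNIV. A $ i $ j))"
    using \<alpha>(1) by (rule mult_left_mono)
  moreover have "0 \<le> x $ i - \<alpha> * ((A *v x) $ i / (\<Sum>j\<in>UNIV. A $ i $ j))"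
    using L by (simp add: less_eq_vec_def pagerank_matrix_mult matrix_inv_degree_matrix_mult_nth[OF D])
  ultimately have "0 \<le> (1 - \<alpha>) * x $ i" by (simp add: algebra_simps)
  then have "0 \<le> x $ i" using \<alpha>(2) by (simp add: zero_le_mult_iff)
  then show ?thesis using i by (auto simp: less_eq_vec_def intro: order_trans)
qed

theorem mainTheorem4:
  fixes A D L :: "real^'n^'n" and \<alpha> :: real and w z c \<phi> :: "real^'n"
  assumes "adjacency_matrix A"
    and "D = degree_matrix A"
    and "invertible D"
    and "0 < \<alpha>" and "\<alpha> < 1"
    and "L = pagerank_matrix \<alpha> A"
    and "0 \<le> w"
    and "transpose L *v z = (1 - \<alpha>) *\<^sub>R w"
    and "c = (1 - \<alpha>) *\<^sub>R (matrix_inv D *v w)"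
    and "\<phi> = matrix_inv D *v z"
  shows "(\<forall>f. discrete_potential L UNIV {} c f \<phi>) \<and> 0 \<le> \<phi> \<and> L *v \<phi> = c"
proof -
  have D: "invertible (degree_matrix A)" using assms(2,3) by simp
  \<comment> \<open>L D^-1 z = D^-1 L^T z = (1 - \<alpha>) D^-1 w.\<close>
  have eq: "L *v \<phi> = c"
    using assms pagerank_matrix_mult_matrix_inv_degree_matrix[OF assms(1) D, of \<alpha> z]
    by (simp add: matrix_vector_mult_scaleR del: transpose_matrix_vector)
  have c: "0 \<le> c"
    using assms(2,5,7,9) degree_positive[OF assms(1) D]
    by (simp add: less_eq_vec_def matrix_inv_degree_matrix_mult_nth[OF D] less_imp_le)
  have "0 \<le> \<phi>"
    using pagerank_matrix_minimum_principle[OF assms(1) D, of \<alpha> \<phi>] assms(4-6) eq c by simp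
  \<comment> \<open>For \<Omega> = \<open>UNIV\<close> the compression of L is L itself, and the
    condition on the empty boundary holds vacuously for every f.\<close>
  with eq c show ?thesis
    by (simp add: discrete_potential_def selection_matrix_UNIV transpose_mat less_eq_vec_def)
qed

end
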